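(* Let $R$ be a unital ring with involution $*$ and let $a\in R$ be Moore-Penrose invertible. Then: (i) $a$ is core invertible if and only if $a$ is invertible along $aa^*$. In this case the inverse of $a$ along $aa^*$ coincides with the core inverse of $a$. (ii) $a$ is dual core invertible if and only if $a$ is invertible along $a^*a$. In this case the inverse of $a$ along $a^*a$ coincides with the dual core inverse of $a$.
   Context: For $a\in R$: $aR=\{ax:x\in R\}$, $Ra=\{xa:x\in R\}$. The element $a$ is Moore-Penrose invertible if there is $x\in R$ with $axa=a$, $xax=x$, $(ax)^*=ax$, $(xa)^*=xa$. A core inverse of $a$ is an $x\in R$ with $axa=a$, $xR=aR$, $Rx=Ra^*$; a dual core inverse of $a$ is an $x\in R$ with $axa=a$, $xR=a^*R$, $Rx=Ra$ (each is unique when it exists); $a$ is (dual) core invertible if it has a (dual) core inverse. For $a,d\in R$, an element $x\in R$ is an inverse of $a$ along $d$ if $xad=d=dax$ and $x\leq_{\mathcal H}d$, where $x\leq_{\mathcal H}d$ means $Rx\subseteq Rd$ and $xR\subseteq dR$; such $x$ is unique when it exists, and then $a$ is called invertible along $d$. *)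

theory Defs
  imports Main
begin

text \<open>
  The class extends \<^class>\<open>ring\<close> and \<^class>\<open>monoid_mult\<close> rather than
  \<^class>\<open>ring_1\<close>, since the latter assumes \<open>0 \<noteq> 1\<close> and would exclude the zero ring.
\<close>

class involutive_ring = ring + monoid_mult +
  fixes star :: "'a \<Rightarrow> 'a"
  assumes star_star: "star (star x) = x"
    and star_add: "star (x + y) = star x + star y"
    and star_mult: "star (x * y) = star y * star x"

definition right_mults :: "'a::times \<Rightarrow> 'a set" where
  "right_mults a = {a * x | x. True}"

definition left_mults :: "'a::times \<Rightarrow> 'a set" where
  "left_mults a = {x * a | x. True}"

definition mp_invertible :: "'a::involutive_ring \<Rightarrow> bool" where
  "mp_invertible a \<longleftrightarrow>
     (\<exists>x. a * x * a = a \<and> x * a * x = x \<and> star (a * x) = a * x \<and> star (x * a) = x * a)"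

definition is_core_inverse :: "'a::involutive_ring \<Rightarrow> 'a \<Rightarrow> bool" where
  "is_core_inverse a x \<longleftrightarrow>
     a * x * a = a \<and> right_mults x = right_mults a \<and> left_mults x = left_mults (star a)"

definition core_invertible :: "'a::involutive_ring \<Rightarrow> bool" where
  "core_invertible a \<longleftrightarrow> (\<exists>x. is_core_inverse a x)"

definition core_inverse :: "'a::involutive_ring \<Rightarrow> 'a" where
  "core_inverse a = (THE x. is_core_inverse a x)"

definition is_dual_core_inverse :: "'a::involutive_ring \<Rightarrow> 'a \<Rightarrow> bool" where
  "is_dual_core_inverse a x \<longleftrightarrow>
     a * x * a = a \<and> right_mults x = right_mults (star a) \<and> left_mults x = left_mults a"

definition dual_core_invertible :: "'a::involutive_ring \<Rightarrow> bool" where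
  "dual_core_invertible a \<longleftrightarrow> (\<exists>x. is_dual_core_inverse a x)"

definition dual_core_inverse :: "'a::involutive_ring \<Rightarrow> 'a" where
  "dual_core_inverse a = (THE x. is_dual_core_inverse a x)"

definition H_le :: "'a::times \<Rightarrow> 'a \<Rightarrow> bool" where
  "H_le x d \<longleftrightarrow> left_mults x \<subseteq> left_mults d \<and> right_mults x \<subseteq> right_mults d"

definition is_inverse_along :: "'a::times \<Rightarrow> 'a \<Rightarrow> 'a \<Rightarrow> bool" where
  "is_inverse_along a d x \<longleftrightarrow> x * a * d = d \<and> d = d * a * x \<and> H_le x d"

definition invertible_along :: "'a::times \<Rightarrow> 'a \<Rightarrow> bool" where
  "invertible_along a d \<longleftrightarrow> (\<exists>x. is_inverse_along a d x)"

definition inverse_along :: "'a::times \<Rightarrow> 'a \<Rightarrow> 'a" where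
  "inverse_along a d = (THE x. is_inverse_along a d x)"

text \<open>
  Each inverse is unique when it exists, so the descriptions \<^const>\<open>core_inverse\<close>,
  \<^const>\<open>dual_core_inverse\<close> and \<^const>\<open>inverse_along\<close> denote the intended elements
  in the invertible case (and are unspecified otherwise).
\<close>

lemma self_in_right_mults: "(a::'a::monoid_mult) \<in> right_mults a"
  unfolding right_mults_def by (rule CollectI, rule exI[of _ 1]) simp

lemma self_in_left_mults: "(a::'a::monoid_mult) \<in> left_mults a"
  unfolding left_mults_def by (rule CollectI, rule exI[of _ 1]) simp

lemma is_inverse_along_unique:
  fixes a d x y :: "'a::monoid_mult"
  assumes x: "is_inverse_along a d x" and y: "is_inverse_along a d y"
  shows "x = y"
proof -
  obtain u where u: "x = u * d"
    using x self_in_left_mults[of x]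
    unfolding is_inverse_along_def H_le_def left_mults_def by blast
  obtain v where v: "y = d * v"
    using y self_in_right_mults[of y]
    unfolding is_inverse_along_def H_le_def right_mults_def by blast
  have "x = u * (d * a * y)"
    using u y unfolding is_inverse_along_def by simp
  then have "x = x * a * y"
    by (metis u mult.assoc)
  moreover have "y = (x * a * d) * v"
    using v x unfolding is_inverse_along_def by simp
  then have "y = x * a * y"
    by (metis v mult.assoc)
  ultimately show ?thesis by simp
qed

lemma is_core_inverse_props:
  fixes a x :: "'a::involutive_ring"
  assumes "is_core_inverse a x"
  shows "star (a * x) = a * x" and "x * a * x = x" and "x * a * a = a"
proof -
  have axa: "a * x * a = a" and r: "right_mults x = right_mults a"
    and l: "left_mults x = left_mults (star a)"
    using assms unfolding is_core_inverse_def by auto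
  obtain w where w: "x = w * star a"
    using self_in_left_mults[of x] l unfolding left_mults_def by blast
  obtain v where v: "a = x * v"
    using self_in_right_mults[of a] r unfolding right_mults_def by blast
  have "star a = star (a * x * a)" using axa by simp
  then have "star a = star a * star (a * x)" by (simp only: star_mult)
  then have x1: "x = x * star (a * x)" by (metis w mult.assoc)
  then have "a * x = a * x * star (a * x)" by (metis mult.assoc)
  then show h: "star (a * x) = a * x" by (metis star_mult star_star)
  then show xax: "x * a * x = x" using x1 by (simp add: mult.assoc)
  show "x * a * a = a" by (metis v xax mult.assoc)
qed

lemma is_core_inverse_unique:
  fixes a x y :: "'a::involutive_ring"
  assumes x: "is_core_inverse a x" and y: "is_core_inverse a y"
  shows "x = y"
proof -
  have ax: "a * x * a = a" and ay: "a * y * a = a"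
    using x y unfolding is_core_inverse_def by auto
  have "a * x = star ((a * y) * (a * x))"
    using is_core_inverse_props(1)[OF x] ay by (metis mult.assoc)
  also have "\<dots> = (a * x) * (a * y)"
    by (simp only: star_mult[of "a * y"] is_core_inverse_props(1)[OF x]
        is_core_inverse_props(1)[OF y])
  also have "\<dots> = a * y" using ax by (metis mult.assoc)
  finally have eq: "a * x = a * y" .
  obtain u where u: "y = a * u"
    using self_in_right_mults[of y] y unfolding is_core_inverse_def right_mults_def by blast
  have "x = x * a * y" using is_core_inverse_props(2)[OF x] eq by (metis mult.assoc)
  also have "\<dots> = y" using is_core_inverse_props(3)[OF x] u by (metis mult.assoc)
  finally show ?thesis .
qed

lemma right_mults_star: "right_mults (star a) = star ` left_mults (a::'a::involutive_ring)"
proof -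
  have "star a * x \<in> star ` left_mults a" for x
    unfolding left_mults_def
    by (rule image_eqI[of _ _ "star x * a"]) (auto simp: star_mult star_star)
  then show ?thesis
    by (auto simp: right_mults_def left_mults_def star_mult)
qed

lemma left_mults_star: "left_mults (star a) = star ` right_mults (a::'a::involutive_ring)"
proof -
  have "x * star a \<in> star ` right_mults a" for x
    unfolding right_mults_def
    by (rule image_eqI[of _ _ "a * star x"]) (auto simp: star_mult star_star)
  then show ?thesis
    by (auto simp: right_mults_def left_mults_def star_mult)
qed

lemma is_dual_core_inverse_star:
  fixes a x :: "'a::involutive_ring"
  assumes "is_dual_core_inverse a x"
  shows "is_core_inverse (star a) (star x)"
  using assms unfolding is_dual_core_inverse_def is_core_inverse_def
  by (metis left_mults_star right_mults_star star_mult mult.assoc)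

lemma is_dual_core_inverse_unique:
  fixes a x y :: "'a::involutive_ring"
  assumes "is_dual_core_inverse a x" and "is_dual_core_inverse a y"
  shows "x = y"
  using is_core_inverse_unique[OF assms[THEN is_dual_core_inverse_star]]
  by (metis star_star)

lemma core_inverse_eqI: "is_core_inverse a x \<Longrightarrow> core_inverse a = x"
  unfolding core_inverse_def by (blast intro: is_core_inverse_unique)

lemma dual_core_inverse_eqI: "is_dual_core_inverse a x \<Longrightarrow> dual_core_inverse a = x"
  unfolding dual_core_inverse_def by (blast intro: is_dual_core_inverse_unique)

lemma inverse_along_eqI:
  "is_inverse_along a d x \<Longrightarrow> inverse_along a d = (x::'a::monoid_mult)"
  unfolding inverse_along_def by (blast intro: is_inverse_along_unique)

end

theory Submission
  imports Defs
begin

text \<open>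
  A Moore-Penrose inverse \<open>p\<close> of \<open>a\<close> gives \<open>a = a a\<^sup>* p\<^sup>*\<close> and \<open>a\<^sup>* = p a a\<^sup>*\<close>, so that
  \<open>a\<close> and \<open>a a\<^sup>*\<close> generate the same right ideal and \<open>a\<^sup>*\<close> and \<open>a a\<^sup>*\<close> the same left ideal.
  Cancelling with these identities turns \<open>x a a a\<^sup>* = a a\<^sup>* = a a\<^sup>* a x\<close> into \<open>x a a = a\<close> and
  \<open>a\<^sup>* a x = a\<^sup>*\<close>; the second equation says that \<open>a x\<close> is self-adjoint with \<open>a x a = a\<close>.
  Applying the involution, which exchanges the two sides, yields the dual part.
\<close>

lemma right_mults_subset_iff:
  fixes a b :: "'a::monoid_mult"
  shows "right_mults a \<subseteq> right_mults b \<longleftrightarrow> (\<exists>u. a = b * u)"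
proof
  show "\<exists>u. a = b * u" if "right_mults a \<subseteq> right_mults b"
    using that self_in_right_mults[of a] unfolding right_mults_def by blast
  show "right_mults a \<subseteq> right_mults b" if "\<exists>u. a = b * u"
    using that by (auto simp: right_mults_def mult.assoc)
qed

lemma left_mults_subset_iff:
  fixes a b :: "'a::monoid_mult"
  shows "left_mults a \<subseteq> left_mults b \<longleftrightarrow> (\<exists>u. a = u * b)"
proof
  show "\<exists>u. a = u * b" if "left_mults a \<subseteq> left_mults b"
    using that self_in_left_mults[of a] unfolding left_mults_def by blast
  show "left_mults a \<subseteq> left_mults b" if "\<exists>u. a = u * b"
    using that by (auto simp: left_mults_def simp flip: mult.assoc)
qed

text \<open>Since \<open>p * a\<close> is self-adjoint, \<open>star a * star p = p * a\<close>, and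
  starring \<open>a * p * a = a\<close> gives \<open>p * a * star a = star a\<close>.\<close>

lemma mp_invertible_obtain:
  fixes a :: "'a::involutive_ring"
  assumes "mp_invertible a"
  obtains p where "a * star a * star p = a" and "p * a * star a = star a"
proof -
  obtain p where apa: "a * p * a = a" and pa: "star (p * a) = p * a"
    using assms unfolding mp_invertible_def by blast
  have "a * star a * star p = a" by (metis apa pa star_mult mult.assoc)
  moreover have "p * a * star a = star a" by (metis apa pa star_mult mult.assoc)
  ultimately show thesis by (rule that)
qed

lemma mp_invertible_star:
  fixes a :: "'a::involutive_ring"
  assumes "mp_invertible a"
  shows "mp_invertible (star a)"
proof -
  obtain p where "a * p * a = a" "p * a * p = p"
    "star (a * p) = a * p" "star (p * a) = p * a"
    using assms unfolding mp_invertible_def by blast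
  then have "star a * star p * star a = star a \<and> star p * star a * star p = star p \<and>
      star (star a * star p) = star a * star p \<and> star (star p * star a) = star p * star a"
    by (metis star_mult mult.assoc)
  then show ?thesis unfolding mp_invertible_def by blast
qed

text \<open>Equating the predicates element by element settles existence and the value of the
  inverse together.\<close>

lemma is_core_inverse_iff_is_inverse_along:
  fixes a x :: "'a::involutive_ring"
  assumes "mp_invertible a"
  shows "is_core_inverse a x \<longleftrightarrow> is_inverse_along a (a * star a) x"
proof
  obtain p where p: "a * star a * star p = a" and p': "p * a * star a = star a"
    using assms by (rule mp_invertible_obtain)
  {
    assume x: "is_core_inverse a x"
    then have axa: "a * x * a = a"
      and "\<exists>u. x = u * star a" and "\<exists>v. x = a * v"
      unfolding is_core_inverse_def
      by (auto simp flip: right_mults_subset_iff left_mults_subset_iff)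
    then obtain u v where u: "x = u * star a" and v: "x = a * v" by blast
    have "x * a * (a * star a) = a * star a"
      using is_core_inverse_props(3)[OF x] by (metis mult.assoc)
    moreover have "star a * (a * x) = star a"
      by (metis axa is_core_inverse_props(1)[OF x] star_mult)
    then have "a * star a * a * x = a * star a" by (simp add: mult.assoc)
    \<comment> \<open>\<open>p\<close> and \<open>star p\<close> rewrite \<open>star a\<close> and
      \<open>a\<close> as multiples of \<open>a * star a\<close>, which gives both halves of
      \<open>H_le\<close>.\<close>
    moreover have "x = (u * p) * (a * star a)" by (metis u p' mult.assoc)
    moreover have "x = (a * star a) * (star p * v)" by (metis v p mult.assoc)
    ultimately show "is_inverse_along a (a * star a) x"
      unfolding is_inverse_along_def H_le_def
      by (metis right_mults_subset_iff left_mults_subset_iff)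
  next
    assume "is_inverse_along a (a * star a) x"
    then have 1: "x * a * (a * star a) = a * star a"
      and 2: "a * star a * a * x = a * star a"
      and "\<exists>u. x = u * (a * star a)" and "\<exists>v. x = a * star a * v"
      unfolding is_inverse_along_def H_le_def
      by (auto simp: right_mults_subset_iff left_mults_subset_iff)
    then obtain u v where u: "x = u * (a * star a)" and v: "x = a * star a * v" by blast
    \<comment> \<open>Multiply \<open>1\<close> on the right by \<open>star p\<close>; below,
      multiply \<open>2\<close> on the left by \<open>p\<close>.\<close>
    have xaa: "x * a * a = a" by (metis 1 p mult.assoc)
    have aax: "star a * a * x = star a" by (metis 2 p' mult.assoc)
    \<comment> \<open>Multiplying by \<open>star x\<close> on the left produces a right-hand side of
      the form \<open>star y * y\<close>, which is self-adjoint.\<close>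
    then have "star (a * x) = star (a * x) * (a * x)" by (metis star_mult mult.assoc)
    then have "star (a * x) = a * x" by (metis star_mult star_star)
    then have "a * x * a = a" by (metis aax star_mult star_star mult.assoc)
    moreover have "right_mults x \<subseteq> right_mults a" "right_mults a \<subseteq> right_mults x"
      unfolding right_mults_subset_iff using v xaa by (metis mult.assoc)+
    moreover have "left_mults x \<subseteq> left_mults (star a)" "left_mults (star a) \<subseteq> left_mults x"
      unfolding left_mults_subset_iff using u aax by (metis mult.assoc)+
    ultimately show "is_core_inverse a x"
      unfolding is_core_inverse_def by blast
  }
qed

lemma is_dual_core_inverse_iff_star:
  fixes a x :: "'a::involutive_ring"
  shows "is_dual_core_inverse a x \<longleftrightarrow> is_core_inverse (star a) (star x)"
proof
  assume x: "is_core_inverse (star a) (star x)"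
  have "a * x * a = star (star a * star x * star a)"
    by (simp add: star_mult star_star mult.assoc)
  with x show "is_dual_core_inverse a x"
    unfolding is_dual_core_inverse_def is_core_inverse_def
    by (metis left_mults_star right_mults_star star_star)
qed (rule is_dual_core_inverse_star)

text \<open>The involution swaps the two equations and the two inclusions in \<open>H_le\<close>, so
  the notion is its own dual.\<close>

lemma is_inverse_along_star:
  fixes a d x :: "'a::involutive_ring"
  assumes "is_inverse_along a d x"
  shows "is_inverse_along (star a) (star d) (star x)"
proof -
  have "x * a * d = d" "d * a * x = d"
    using assms unfolding is_inverse_along_def by auto
  then have "star x * star a * star d = star d" "star d * star a * star x = star d"
    by (metis star_mult mult.assoc)+
  then show ?thesis
    using assms unfolding is_inverse_along_def H_le_def
    by (simp add: left_mults_star right_mults_star image_mono)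
qed

lemma is_dual_core_inverse_iff_is_inverse_along:
  fixes a x :: "'a::involutive_ring"
  assumes "mp_invertible a"
  shows "is_dual_core_inverse a x \<longleftrightarrow> is_inverse_along a (star a * a) x"
proof -
  have "is_dual_core_inverse a x \<longleftrightarrow> is_inverse_along (star a) (star a * a) (star x)"
    using is_core_inverse_iff_is_inverse_along[OF mp_invertible_star[OF assms], of "star x"]
    by (simp add: is_dual_core_inverse_iff_star star_star)
  \<comment> \<open>\<open>star a * a\<close> is self-adjoint, so starring leaves the element along
    which one inverts unchanged.\<close>
  also have "\<dots> \<longleftrightarrow> is_inverse_along a (star a * a) x"
    using is_inverse_along_star[of a "star a * a" x]
      is_inverse_along_star[of "star a" "star a * a" "star x"]
    by (auto simp: star_mult star_star)
  finally show ?thesis .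
qed

theorem theorem4p3:
  fixes a :: "'a::involutive_ring"
  assumes "mp_invertible a"
  shows "((core_invertible a \<longleftrightarrow> invertible_along a (a * star a)) \<and>
          (core_invertible a \<longrightarrow> inverse_along a (a * star a) = core_inverse a)) \<and>
         ((dual_core_invertible a \<longleftrightarrow> invertible_along a (star a * a)) \<and>
          (dual_core_invertible a \<longrightarrow> inverse_along a (star a * a) = dual_core_inverse a))"
  by (simp add: core_invertible_def core_inverse_def dual_core_invertible_def
      dual_core_inverse_def invertible_along_def inverse_along_def
      is_core_inverse_iff_is_inverse_along[OF assms]
      is_dual_core_inverse_iff_is_inverse_along[OF assms])

end
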